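(* Let $\mathbb K$ be a field of characteristic $0$ and let $b_{i,j}$ ($i,j\ge0$) be indeterminates. Let $\hat G(x,L)$ be the power series solution (with coefficients in $\mathbb K[b_{i,j}:i,j\ge 0][L]$) of the two-insertion-place Dyson--Schwinger equation $$\hat G(x,L)=1+x\,\hat G(x,\partial/\partial\rho_1)^{-1}\,\hat G(x,\partial/\partial\rho_2)^{-1}\,\big(e^{L(\rho_1+\rho_2)}-1\big)\hat F(\rho_1,\rho_2)\Big|_{\rho_1=\rho_2=0},\qquad(\rho_1+\rho_2)\hat F(\rho_1,\rho_2)=\sum_{i,j\ge0}b_{i,j}\rho_1^i\rho_2^j.$$ Let $G(x,L)$ be the power series solution (with coefficients in $\mathbb K[a_0,a_1,\dots][L]$, the $a_i$ being indeterminates) of the single-insertion-place Dyson--Schwinger equation $$G(x,L)=1+x\,G(x,\partial/\partial\rho)^{-2}\,\big(e^{L\rho}-1\big)F(\rho)\Big|_{\rho=0},\qquad F(\rho)=\sum_{i\ge0}a_i\rho^{i-1}.$$ Then no linear substitution expressing each $a_k$ as a $\mathbb K$-linear combination of the $b_{i,j}$ transforms $G(x,L)$ into $\hat G(x,L)$.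
   Context: In these equations, an expression such as $G(x,\partial/\partial\rho)^{-2}$ means: expand $G(x,L)^{-2}$ as a power series in $x$, whose coefficients are polynomials in $L$, and replace $L$ by $\partial/\partial\rho$ in each coefficient; the resulting differential operators are applied coefficientwise in $x$ to the power series in $\rho$ (respectively $\rho_1,\rho_2$) to their right, after which $\rho$ (respectively $\rho_1,\rho_2$) is set to $0$. Note that $(e^{L\rho}-1)F(\rho)$ and $(e^{L(\rho_1+\rho_2)}-1)\hat F(\rho_1,\rho_2)$ are honest power series in the $\rho$ variables. Each equation determines its solution recursively, with constant term $1$ in $x$. *)

theory Defs
  imports
    "HOL-Library.Poly_Mapping"
    "HOL-Library.Product_Lexorder"
    "HOL-Computational_Algebra.Computational_Algebra"
begin

text \<open>
  The polynomial ring over \<open>'k\<close> in indeterminates indexed by \<open>'v\<close>: a polynomial is a finitely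
  supported map from monomials (finitely supported exponent functions) to coefficients.
  The linear order on \<open>'v\<close> serves only to obtain the instance \<open>idom\<close>; for
  \<open>'v = nat \<times> nat\<close> it comes from \<open>HOL-Library.Product_Lexorder\<close>.
\<close>

type_synonym ('v, 'k) mpol = "('v \<Rightarrow>\<^sub>0 nat) \<Rightarrow>\<^sub>0 'k"

definition mp_const :: "'k::field_char_0 \<Rightarrow> ('v::linorder, 'k) mpol" where
  "mp_const c = Poly_Mapping.single 0 c"

definition mp_var :: "'v::linorder \<Rightarrow> ('v, 'k::field_char_0) mpol" where
  "mp_var v = Poly_Mapping.single (Poly_Mapping.single v 1) 1"

definition mp_subst ::
  "('v::linorder \<Rightarrow> ('w::linorder, 'k::field_char_0) mpol) \<Rightarrow> ('v, 'k) mpol \<Rightarrow> ('w, 'k) mpol" where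
  "mp_subst s p = (\<Sum>m\<in>Poly_Mapping.keys p.
     mp_const (Poly_Mapping.lookup p m) *
       (\<Prod>v\<in>Poly_Mapping.keys m. s v ^ Poly_Mapping.lookup m v))"

definition mp_linear_form :: "('v::linorder \<Rightarrow>\<^sub>0 'k::field_char_0) \<Rightarrow> ('v, 'k) mpol" where
  "mp_linear_form c =
     (\<Sum>v\<in>Poly_Mapping.keys c. mp_const (Poly_Mapping.lookup c v) * mp_var v)"

text \<open>
  With \<open>R = ('v, 'k) mpol\<close>, a series \<open>G(x,L)\<close> in \<open>R[L][[x]]\<close> has type \<open>R poly fps\<close>, where the
  \<open>poly\<close> variable is \<open>L\<close> and the \<open>fps\<close> variable is \<open>x\<close>.
  The same type is used for \<open>R[L][[\<rho>]]\<close>, and \<open>R poly fps fps\<close> for \<open>R[L][[\<rho>\<^sub>1,\<rho>\<^sub>2]]\<close>, with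
  \<open>\<rho>\<^sub>1\<close> the inner and \<open>\<rho>\<^sub>2\<close> the outer variable: the coefficient of \<open>\<rho>\<^sub>1\<^sup>i \<rho>\<^sub>2\<^sup>j\<close> in \<open>Q\<close> is \<open>Q $ j $ i\<close>.
\<close>

definition series_subst ::
  "('v::linorder \<Rightarrow> ('w::linorder, 'k::field_char_0) mpol) \<Rightarrow>
     ('v, 'k) mpol poly fps \<Rightarrow> ('w, 'k) mpol poly fps" where
  "series_subst s G = Abs_fps (\<lambda>n. map_poly (mp_subst s) (G $ n))"

text \<open>The inverse of a series with constant term 1 over a ring (not necessarily a field).\<close>

definition series_inv :: "'a::comm_ring_1 fps \<Rightarrow> 'a fps" where
  "series_inv G = fps_right_inverse G 1"

text \<open>
  \<open>p(D) Q\<close> for \<open>p = \<Sum>\<^sub>k p\<^sub>k L\<^sup>k\<close>; \<open>emb\<close> embeds the coefficients \<open>p\<^sub>k\<close> in the ring of \<open>Q\<close>.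
  Only the \<open>L\<close> of \<open>p\<close> is replaced by \<open>D\<close>; the \<open>L\<close> occurring in \<open>Q\<close> is untouched.
\<close>

definition diff_op ::
  "('r \<Rightarrow> 'q) \<Rightarrow> ('q \<Rightarrow> 'q) \<Rightarrow> 'r::comm_ring_1 poly \<Rightarrow> 'q \<Rightarrow> 'q::comm_ring_1" where
  "diff_op emb D p Q = (\<Sum>k\<le>degree p. emb (poly.coeff p k) * (D ^^ k) Q)"

subsection \<open>One insertion place\<close>

text \<open>\<open>e\<^bsup>L\<rho>\<^esup>\<close>; the type has no division, so \<open>fps_exp\<close> is not available over \<open>R[L]\<close>.\<close>

definition exp1 :: "('v::linorder, 'k::field_char_0) mpol poly fps" where
  "exp1 = Abs_fps (\<lambda>n. monom (mp_const (1 / fact n)) n)"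

definition F1 :: "(nat, 'k::field_char_0) mpol poly fls" where
  "F1 = fls_X_inv * fps_to_fls (Abs_fps (\<lambda>i. [:mp_var i:]))"

definition kernel1 :: "(nat, 'k::field_char_0) mpol poly fps" where
  "kernel1 = fls_regpart (fps_to_fls (exp1 - 1) * F1)"

definition dse1_rhs ::
  "(nat, 'k::field_char_0) mpol poly fps \<Rightarrow> (nat, 'k) mpol poly fps" where
  "dse1_rhs G = 1 + fps_X * Abs_fps (\<lambda>n.
     diff_op (\<lambda>c. fps_const [:c:]) fps_deriv (((series_inv G)\<^sup>2) $ n) kernel1 $ 0)"

definition dse1_solution :: "(nat, 'k::field_char_0) mpol poly fps \<Rightarrow> bool" where
  "dse1_solution G \<longleftrightarrow> G = dse1_rhs G"

subsection \<open>Two insertion places\<close>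

definition rho1 :: "'a::comm_ring_1 fps fps" where
  "rho1 = fps_const fps_X"

definition rho2 :: "'a::comm_ring_1 fps fps" where
  "rho2 = fps_X"

definition partial1 :: "'a::comm_ring_1 fps fps \<Rightarrow> 'a fps fps" where
  "partial1 Q = Abs_fps (\<lambda>j. fps_deriv (Q $ j))"

definition partial2 :: "'a::comm_ring_1 fps fps \<Rightarrow> 'a fps fps" where
  "partial2 Q = fps_deriv Q"

text \<open>
  The coefficient of \<open>\<rho>\<^sub>1\<^sup>i \<rho>\<^sub>2\<^sup>j\<close> in \<open>\<Sum>\<^sub>n L\<^sup>n (\<rho>\<^sub>1 + \<rho>\<^sub>2)\<^sup>n / n!\<close>, where by degree only terms with
  \<open>n \<le> i + j\<close> contribute.
\<close>

definition exp2 :: "('v::linorder, 'k::field_char_0) mpol poly fps fps" where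
  "exp2 = Abs_fps (\<lambda>j. Abs_fps (\<lambda>i.
     \<Sum>n\<le>i + j. monom (mp_const (1 / fact n)) n * ((rho1 + rho2) ^ n) $ j $ i))"

definition B2 :: "(nat \<times> nat, 'k::field_char_0) mpol poly fps fps" where
  "B2 = Abs_fps (\<lambda>j. Abs_fps (\<lambda>i. [:mp_var (i, j):]))"

text \<open>\<open>F2\<close> lives in the field of fractions of \<open>R[L][[\<rho>\<^sub>1,\<rho>\<^sub>2]]\<close>.\<close>

definition F2 :: "(nat \<times> nat, 'k::field_char_0) mpol poly fps fps fract" where
  "F2 = Fraction_Field.Fract B2 (rho1 + rho2)"

text \<open>The power series representing \<open>(e\<^bsup>L(\<rho>\<^sub>1+\<rho>\<^sub>2)\<^esup> - 1) F2\<close>; it exists by lemma \<open>kernel2\<close> below.\<close>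

definition kernel2 :: "(nat \<times> nat, 'k::field_char_0) mpol poly fps fps" where
  "kernel2 = (THE P.
     Fraction_Field.Fract P 1 = Fraction_Field.Fract (exp2 - 1) 1 * F2)"

definition dse2_rhs ::
  "(nat \<times> nat, 'k::field_char_0) mpol poly fps \<Rightarrow> (nat \<times> nat, 'k) mpol poly fps" where
  "dse2_rhs G = 1 + fps_X * Abs_fps (\<lambda>n. \<Sum>m\<le>n.
     diff_op (\<lambda>c. fps_const (fps_const [:c:])) partial1 (series_inv G $ m)
       (diff_op (\<lambda>c. fps_const (fps_const [:c:])) partial2 (series_inv G $ (n - m)) kernel2)
     $ 0 $ 0)"

definition dse2_solution :: "(nat \<times> nat, 'k::field_char_0) mpol poly fps \<Rightarrow> bool" where
  "dse2_solution G \<longleftrightarrow> G = dse2_rhs G"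

subsection \<open>The two kernels are power series\<close>

lemma kernel1:
  "fps_to_fls kernel1 = fps_to_fls (exp1 - 1) * (F1 :: (nat, 'k::field_char_0) mpol poly fls)"
proof -
  let ?e = "exp1 - 1 :: (nat, 'k) mpol poly fps"
  have "?e $ 0 = 0"
    by (simp add: exp1_def mp_const_def monom_0 flip: one_poly_eq_simps(1))
  then have E: "?e = fps_X * fps_shift 1 ?e"
    by (intro fps_ext) simp
  have X: "fps_to_fls fps_X * (fls_X_inv :: (nat, 'k) mpol poly fls) = 1"
    by (simp add: fls_X_inv_times_conv_shift mult.commute[of _ fls_X_inv])
  let ?A = "Abs_fps (\<lambda>i. [:mp_var i:]) :: (nat, 'k) mpol poly fps"
  have "fps_to_fls ?e * F1 =
      fps_to_fls fps_X * fls_X_inv * (fps_to_fls (fps_shift 1 ?e) * fps_to_fls ?A)"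
    by (subst E) (simp only: F1_def fls_times_fps_to_fls mult.assoc mult.left_commute)
  also have "\<dots> = fps_to_fls (fps_shift 1 ?e * ?A)"
    by (simp only: X mult_1 fls_times_fps_to_fls)
  finally show ?thesis
    by (simp add: kernel1_def)
qed

lemma rho_mult_nth:
  "((rho1 + rho2) * Q) $ j $ i =
     (if i = 0 then 0 else Q $ j $ (i - 1)) + (if j = 0 then 0 else Q $ (j - 1) $ i)"
  by (simp add: rho1_def rho2_def distrib_right)

lemma rho_nonzero: "rho1 + rho2 \<noteq> (0 :: 'a::comm_ring_1 fps fps)"
proof
  assume "rho1 + rho2 = (0 :: 'a fps fps)"
  then have "(rho1 + rho2 :: 'a fps fps) $ 1 $ 0 = 0" by simp
  then show False by (simp add: rho1_def rho2_def)
qed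

definition exp2_quot :: "('v::linorder, 'k::field_char_0) mpol poly fps fps" where
  "exp2_quot = Abs_fps (\<lambda>j. Abs_fps (\<lambda>i.
     \<Sum>n\<le>i + j. monom (mp_const (1 / fact (Suc n))) (Suc n) * ((rho1 + rho2) ^ n) $ j $ i))"

lemma rho_exp2_quot:
  "(rho1 + rho2) * exp2_quot = (exp2 - 1 :: ('v::linorder, 'k::field_char_0) mpol poly fps fps)"
proof (intro fps_ext)
  fix j i
  let ?c = "\<lambda>n. monom (mp_const (1 / fact n)) n :: ('v, 'k) mpol poly"
  let ?r = "rho1 + rho2 :: ('v, 'k) mpol poly fps fps"
  have c0: "?c 0 = 1"
    by (simp add: mp_const_def monom_0 flip: one_poly_eq_simps(1))
  have "exp2 $ j $ i = ?c 0 * (?r ^ 0) $ j $ i + (\<Sum>n<i + j. ?c (Suc n) * (?r ^ Suc n) $ j $ i)"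
    unfolding exp2_def
    by (simp only: fps_nth_Abs_fps sum.lessThan_Suc_shift flip: lessThan_Suc_atMost)
  also have "?c 0 * (?r ^ 0) $ j $ i = 1 $ j $ i"
    by (simp only: c0 power_0 mult_1)
  also have "(\<Sum>n<i + j. ?c (Suc n) * (?r ^ Suc n) $ j $ i) = (?r * exp2_quot) $ j $ i"
  proof (cases "i + j")
    case 0
    then show ?thesis by (simp add: rho1_def rho2_def)
  next
    case (Suc N)
    then have N: "N = i + j - 1" by simp
    show ?thesis
      unfolding rho_mult_nth power_Suc Suc lessThan_Suc_atMost
      by (simp add: exp2_quot_def N distrib_left sum.distrib)
  qed
  finally show "((?r * exp2_quot) $ j) $ i = (exp2 - 1 :: ('v, 'k) mpol poly fps fps) $ j $ i"
    by simp
qed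

lemma kernel2_eq: "kernel2 = exp2_quot * B2"
  unfolding kernel2_def F2_def
  by (rule the_equality)
    (simp_all add: eq_fract rho_nonzero mult_ac flip: rho_exp2_quot)

lemma kernel2:
  "Fraction_Field.Fract kernel2 1 = Fraction_Field.Fract (exp2 - 1) 1 * F2"
  "(rho1 + rho2) * kernel2 = (exp2 - 1) * B2"
  "Fraction_Field.Fract (rho1 + rho2) 1 * F2 = Fraction_Field.Fract B2 1"
  by (simp_all add: kernel2_eq F2_def eq_fract rho_nonzero mult_ac flip: rho_exp2_quot)

subsection \<open>Each equation has exactly one solution, and its constant term is 1\<close>

lemma fps_causal_fixed_point:
  fixes \<Phi> :: "'a::zero fps \<Rightarrow> 'a fps"
  assumes causal: "\<And>f g n. (\<And>i. i < n \<Longrightarrow> f $ i = g $ i) \<Longrightarrow> \<Phi> f $ n = \<Phi> g $ n"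
  shows "\<exists>!f. f = \<Phi> f"
proof (rule ex_ex1I)
  define f where "f = Abs_fps (\<lambda>n. (\<Phi> ^^ Suc n) 0 $ n)"
  have stable: "(\<Phi> ^^ m) 0 $ n = (\<Phi> ^^ Suc n) 0 $ n" if "n < m" for m n
    using that
  proof (induction n arbitrary: m rule: less_induct)
    case (less n)
    then obtain m' where m: "m = Suc m'" by (cases m) auto
    have "(\<Phi> ^^ m') 0 $ i = (\<Phi> ^^ n) 0 $ i" if "i < n" for i
      using less.IH[of i m'] less.IH[of i n] less.prems that m by simp
    then show ?case
      unfolding m funpow.simps comp_apply by (rule causal)
  qed
  have "f $ n = \<Phi> f $ n" for n
  proof -
    have "\<Phi> ((\<Phi> ^^ n) 0) $ n = \<Phi> f $ n"
      by (rule causal) (simp only: f_def fps_nth_Abs_fps stable[where m = n])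
    then show ?thesis by (simp add: f_def)
  qed
  then show "\<exists>f. f = \<Phi> f" by (metis fps_ext)
next
  fix f g assume f: "f = \<Phi> f" and g: "g = \<Phi> g"
  have "f $ n = g $ n" for n
  proof (induction n rule: less_induct)
    case (less n)
    then have "\<Phi> f $ n = \<Phi> g $ n" by (rule causal)
    with f g show ?case by simp
  qed
  then show "f = g" by (rule fps_ext)
qed

lemma series_inv_causal:
  fixes f g :: "'a::comm_ring_1 fps"
  assumes "\<And>i. i \<le> n \<Longrightarrow> f $ i = g $ i" and "m \<le> n"
  shows "series_inv f $ m = series_inv g $ m"
  using assms(2)
proof (induction m rule: less_induct)
  case (less m)
  show ?case
  proof (cases m)
    case 0
    then show ?thesis by (simp add: series_inv_def)
  next
    case (Suc k)
    have "f $ i * series_inv f $ (m - i) = g $ i * series_inv g $ (m - i)"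
      if "i \<in> {1..m}" for i
      using less.IH[of "m - i"] less.prems assms(1)[of i] that by simp
    then show ?thesis using Suc by (simp add: series_inv_def)
  qed
qed

lemma series_inv_works: "f $ 0 = 1 \<Longrightarrow> f * series_inv f = (1 :: 'a::comm_ring_1 fps)"
  using fps_right_inverse[of f 1] by (simp add: series_inv_def)

lemma dse1_rhs_nth:
  "dse1_rhs G $ 0 = 1"
  "dse1_rhs G $ Suc n =
     diff_op (\<lambda>c. fps_const [:c:]) fps_deriv (((series_inv G)\<^sup>2) $ n) kernel1 $ 0"
  unfolding dse1_rhs_def fps_add_nth fps_one_nth fps_X_mult_nth fps_nth_Abs_fps
  by simp_all

lemma dse2_rhs_nth:
  "dse2_rhs G $ 0 = 1"
  "dse2_rhs G $ Suc n = (\<Sum>m\<le>n.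
     diff_op (\<lambda>c. fps_const (fps_const [:c:])) partial1 (series_inv G $ m)
       (diff_op (\<lambda>c. fps_const (fps_const [:c:])) partial2 (series_inv G $ (n - m)) kernel2)
     $ 0 $ 0)"
  unfolding dse2_rhs_def fps_add_nth fps_one_nth fps_X_mult_nth fps_nth_Abs_fps
  by simp_all

lemma dse1_ex1: "\<exists>!G. dse1_solution G"
  unfolding dse1_solution_def
proof (rule fps_causal_fixed_point)
  fix f g :: "(nat, 'k::field_char_0) mpol poly fps" and n
  assume eq: "\<And>i. i < n \<Longrightarrow> f $ i = g $ i"
  show "dse1_rhs f $ n = dse1_rhs g $ n"
  proof (cases n)
    case (Suc m)
    have "series_inv f $ i = series_inv g $ i" if "i \<le> m" for i
      using series_inv_causal[of m f g i] eq Suc that by simp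
    then have "((series_inv f)\<^sup>2) $ m = ((series_inv g)\<^sup>2) $ m"
      unfolding power2_eq_square fps_mult_nth by (intro sum.cong) auto
    then show ?thesis by (simp only: dse1_rhs_nth Suc)
  qed (simp add: dse1_rhs_nth)
qed

lemma dse2_ex1: "\<exists>!G. dse2_solution G"
  unfolding dse2_solution_def
proof (rule fps_causal_fixed_point)
  fix f g :: "(nat \<times> nat, 'k::field_char_0) mpol poly fps" and n
  assume eq: "\<And>i. i < n \<Longrightarrow> f $ i = g $ i"
  show "dse2_rhs f $ n = dse2_rhs g $ n"
  proof (cases n)
    case (Suc m)
    have "series_inv f $ i = series_inv g $ i" if "i \<le> m" for i
      using series_inv_causal[of m f g i] eq Suc that by simp
    then show ?thesis
      unfolding Suc dse2_rhs_nth by (intro sum.cong) auto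
  qed (simp add: dse2_rhs_nth)
qed

lemma dse1_nth_0: "dse1_solution G \<Longrightarrow> G $ 0 = 1"
  by (metis dse1_solution_def dse1_rhs_nth(1))

lemma dse2_nth_0: "dse2_solution G \<Longrightarrow> G $ 0 = 1"
  by (metis dse2_solution_def dse2_rhs_nth(1))

end

(*
The coefficient of L in the x^1, ..., x^4 terms already decides the matter.  Write
beta = b_{0,0}, s = b_{1,0} + b_{0,1}, p = b_{1,1}, q = b_{2,0} + b_{0,2}.  Orders 1, 2 and 3 force
a_0 = beta, 2 a_1 = s and 10 a_2 = 4 q + p.  With these values order 4, divided by beta^2, says
that beta divides 3 s (q - p).  Setting beta = 0 in this relation refutes it.
*)

theory Submission
  imports Defs
begin

section \<open>Substitution as a ring homomorphism\<close>

text \<open>Polynomials are finite sums of monomials, so a property closed under sums need only be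
  checked on monomials. This is the induction behind multiplicativity of substitution.\<close>

lemma poly_mapping_single_add_induct [case_names single add]:
  fixes p :: "'a \<Rightarrow>\<^sub>0 'b::comm_monoid_add"
  assumes single: "\<And>m c. P (Poly_Mapping.single m c)"
    and add: "\<And>p q. P p \<Longrightarrow> P q \<Longrightarrow> P (p + q)"
  shows "P p"
proof (induction p rule: update_induct)
  case const
  \<comment> \<open>The zero map is a single term with coefficient 0 at any key, so the
    \<open>single\<close> case covers it.\<close>
  then show ?case using single[of undefined 0] by simp
next
  case (update f a b)
  \<comment> \<open>The new key \<open>a\<close> lies outside the support of \<open>f\<close>, so
    overwriting there is the same as adding.\<close>
  then have "Poly_Mapping.update a b f = f + Poly_Mapping.single a b"
    by (intro poly_mapping_eqI)
      (auto simp: lookup_update lookup_add lookup_single when_def in_keys_iff)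
  then show ?case using add update single by simp
qed

text \<open>Monomials outside the support contribute 0. Sums for \<open>p\<close>, \<open>q\<close>
  and \<open>p + q\<close> can thus run over one common index set, even when terms cancel in
  \<open>p + q\<close>.\<close>

lemma mp_subst_superset:
  assumes "finite A" "Poly_Mapping.keys p \<subseteq> A"
  shows "mp_subst s p = (\<Sum>m\<in>A. mp_const (Poly_Mapping.lookup p m) *
       (\<Prod>v\<in>Poly_Mapping.keys m. s v ^ Poly_Mapping.lookup m v))"
  unfolding mp_subst_def
  by (rule sum.mono_neutral_left) (use assms in \<open>auto simp: in_keys_iff mp_const_def\<close>)

lemma mp_const_add: "mp_const (a + b) = mp_const a + mp_const b"
  by (simp add: mp_const_def single_add)

lemma mp_const_mult: "mp_const (a * b) = mp_const a * mp_const b"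
  by (simp add: mp_const_def mult_single)

lemma mp_const_0: "mp_const 0 = 0"
  by (simp add: mp_const_def)

lemma mp_const_1: "mp_const 1 = 1"
  by (simp add: mp_const_def)

lemma mp_const_of_nat: "mp_const (of_nat n) = of_nat n"
  by (induction n) (simp_all add: mp_const_add mp_const_0 mp_const_1)

lemma mp_subst_add: "mp_subst s (p + q) = mp_subst s p + mp_subst s q"
proof -
  let ?A = "Poly_Mapping.keys p \<union> Poly_Mapping.keys q"
  have "Poly_Mapping.keys (p + q) \<subseteq> ?A" by (rule Poly_Mapping.keys_add)
  then show ?thesis
    by (simp add: mp_subst_superset[where A = ?A] lookup_add mp_const_add distrib_right
        sum.distrib)
qed

lemma mp_subst_single:
  "mp_subst s (Poly_Mapping.single m c) =
     mp_const c * (\<Prod>v\<in>Poly_Mapping.keys m. s v ^ Poly_Mapping.lookup m v)"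
  by (subst mp_subst_superset[where A = "{m}"]) simp_all

lemma mp_subst_0: "mp_subst s 0 = 0"
  by (simp add: mp_subst_def)

text \<open>Over the union of both supports, variables of exponent 0 contribute the factor 1, and
  the claim reduces to adding exponents.\<close>

lemma monomial_prod_add:
  fixes s :: "'v::linorder \<Rightarrow> 'a::comm_ring_1"
  shows "(\<Prod>v\<in>Poly_Mapping.keys (m + n). s v ^ Poly_Mapping.lookup (m + n) v) =
    (\<Prod>v\<in>Poly_Mapping.keys m. s v ^ Poly_Mapping.lookup m v) *
    (\<Prod>v\<in>Poly_Mapping.keys n. s v ^ Poly_Mapping.lookup n v)"
proof -
  let ?A = "Poly_Mapping.keys m \<union> Poly_Mapping.keys n"
  have ext: "(\<Prod>v\<in>Poly_Mapping.keys k. s v ^ Poly_Mapping.lookup k v) =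
      (\<Prod>v\<in>?A. s v ^ Poly_Mapping.lookup k v)" if "Poly_Mapping.keys k \<subseteq> ?A" for k
    by (rule prod.mono_neutral_left) (use that in \<open>auto simp: in_keys_iff\<close>)
  have "(\<Prod>v\<in>Poly_Mapping.keys (m + n). s v ^ Poly_Mapping.lookup (m + n) v) =
      (\<Prod>v\<in>?A. s v ^ Poly_Mapping.lookup (m + n) v)"
    by (rule ext) (rule Poly_Mapping.keys_add)
  then show ?thesis
    by (simp add: ext[of m] ext[of n] lookup_add power_add prod.distrib)
qed

text \<open>Both sides are additive in each factor, so two nested inductions reduce the claim to a
  product of two monomials.\<close>

lemma mp_subst_mult: "mp_subst s (p * q) = mp_subst s p * mp_subst s q"
proof (induction p rule: poly_mapping_single_add_induct)
  case (single m c)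
  show ?case
  proof (induction q rule: poly_mapping_single_add_induct)
    case (single n d)
    show ?case
      by (simp add: mult_single mp_subst_single monomial_prod_add mp_const_mult mult_ac)
  qed (simp add: distrib_left mp_subst_add)
qed (simp add: distrib_right mp_subst_add)

lemma mp_subst_const: "mp_subst s (mp_const c) = mp_const c"
  by (simp add: mp_const_def mp_subst_single)

lemma mp_subst_var: "mp_subst s (mp_var v) = s v"
  by (simp add: mp_var_def mp_subst_single mp_const_1)

lemma mp_subst_1: "mp_subst s 1 = 1"
  using mp_subst_const[of s 1] by (simp add: mp_const_1)

lemma mp_subst_uminus: "mp_subst s (- p) = - mp_subst s p"
  using mp_subst_add[of s p "- p"] by (simp add: mp_subst_0 add_eq_0_iff)

lemma mp_subst_diff: "mp_subst s (p - q) = mp_subst s p - mp_subst s q"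
  using mp_subst_add[of s p "- q"] by (simp add: mp_subst_uminus)

lemma mp_subst_of_nat: "mp_subst s (of_nat n) = of_nat n"
  by (induction n) (simp_all add: mp_subst_0 mp_subst_1 mp_subst_add)

lemma mp_subst_numeral: "mp_subst s (numeral n) = numeral n"
  using mp_subst_of_nat[of s "numeral n"] by simp

lemma mp_subst_power: "mp_subst s (p ^ n) = mp_subst s p ^ n"
  by (induction n) (simp_all add: mp_subst_1 mp_subst_mult)

text \<open>Substituting 1 for every variable sends \<open>mp_var v\<close> to 1 but 0 to 0.\<close>

lemma mp_var_nonzero: "(mp_var v :: ('v::linorder, 'k::field_char_0) mpol) \<noteq> 0"
  using mp_subst_var[of "\<lambda>_. 1 :: ('v, 'k) mpol" v] by (auto simp: mp_subst_0)

section \<open>Coefficients of the two kernels\<close>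

text \<open>The binomial theorem, with \<open>rho_mult_nth\<close> supplying Pascal's rule in the
  induction.\<close>

lemma rho_power_nth:
  "((rho1 + rho2) ^ n :: 'a::comm_ring_1 fps fps) $ j $ i =
     (if n = i + j then of_nat (n choose i) else 0)"
proof (induction n arbitrary: i j)
  case 0
  then show ?case by (auto simp: fps_one_nth)
next
  case (Suc n)
  show ?case
    unfolding power_Suc rho_mult_nth Suc by (cases i; cases j) auto
qed

text \<open>By homogeneity only the term \<open>n = i + j\<close> of the defining sum
  survives.\<close>

lemma exp2_quot_nth:
  "exp2_quot $ j $ i =
     monom (mp_const (1 / fact (Suc (i + j))) * of_nat (i + j choose i)) (Suc (i + j))"
  unfolding exp2_quot_def fps_nth_Abs_fps rho_power_nth
  by (simp add: if_distrib[of "\<lambda>x. _ * x"] of_nat_monom mult_monom cong: if_cong)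

lemma kernel1_nth:
  "kernel1 $ k = (\<Sum>n\<le>k. monom (mp_const (1 / fact (Suc n)) * mp_var (k - n)) (Suc n))"
proof -
  let ?A = "Abs_fps (\<lambda>i. [:mp_var i:]) :: (nat, 'a) mpol poly fps"
  have X: "fps_to_fls fps_X * (fls_X_inv :: (nat, 'a) mpol poly fls) = 1"
    by (simp add: fls_X_inv_times_conv_shift mult.commute[of _ fls_X_inv])
  \<comment> \<open>Multiplying by \<rho> clears the simple pole of \<open>F1\<close>; the identity
    then descends from Laurent series to power series.\<close>
  have "fps_to_fls (fps_X * kernel1) = fps_to_fls fps_X * fls_X_inv * fps_to_fls ((exp1 - 1) * ?A)"
    by (simp only: fls_times_fps_to_fls kernel1 F1_def mult_ac)
  then have "fps_X * kernel1 = (exp1 - 1) * ?A"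
    by (simp only: X mult_1 fps_to_fls_eq_iff)
  then have "kernel1 $ k = ((exp1 - 1) * ?A) $ Suc k"
    by (metis fps_X_mult_nth diff_Suc_1 nat.distinct(1))
  \<comment> \<open>The constant term of \<open>exp1 - 1\<close> vanishes, so the convolution starts
    at index 1.\<close>
  also have "\<dots> = (\<Sum>n\<le>k. (exp1 - 1) $ Suc n * ?A $ (k - n))"
    unfolding fps_mult_nth
    by (simp add: atLeast0AtMost sum.atMost_Suc_shift exp1_def monom_0 mp_const_1 one_pCons
        del: sum.atMost_Suc)
  finally show ?thesis
    by (simp add: exp1_def mult_monom flip: monom_0)
qed

section \<open>Differential operators evaluated at \<rho> = 0\<close>

lemma partial1_funpow_nth: "(partial1 ^^ k) Q $ j = (fps_deriv ^^ k) (Q $ j)"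
  by (induction k) (simp_all add: partial1_def)

text \<open>Coefficients beyond the degree vanish. A fixed bound \<open>N\<close> avoids having to
  know the exact degree of a polynomial with symbolic coefficients.\<close>

lemma diff_op_sum_lessThan:
  assumes "degree p < N" and "emb 0 = 0"
  shows "diff_op emb D p Q = (\<Sum>k<N. emb (poly.coeff p k) * (D ^^ k) Q)"
  unfolding diff_op_def
  by (rule sum.mono_neutral_left) (use assms in \<open>auto simp: coeff_eq_0\<close>)

lemma fact_mult_poly: "fact n * p = smult (fact n) (p :: 'a::{comm_ring_1, ring_char_0} poly)"
proof -
  have "fact n * p = of_nat (fact n) * p"
    by simp
  then show ?thesis
    by (simp only: of_nat_poly) simp
qed

lemma smult_sum_right: "smult c (sum f A) = (\<Sum>x\<in>A. smult c (f x))"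
  by (induction A rule: infinite_finite_induct) (simp_all add: smult_add_right)

text \<open>The k-th derivative at 0 is k! times the k-th coefficient, so applying the operator
  becomes a finite weighted sum.\<close>

lemma diff_op1_nth_0:
  fixes p :: "'a::{idom, ring_char_0} poly"
  assumes "degree p < N"
  shows "diff_op (\<lambda>c. fps_const [:c:]) fps_deriv p Q $ 0 =
    (\<Sum>k<N. smult (poly.coeff p k * fact k) (Q $ k))"
  by (simp add: fact_mult_poly mult.commute diff_op_sum_lessThan[OF assms] fps_sum_nth
      fps_0th_higher_deriv)

lemma fps_fact_mult_nth: "(fact j * F) $ i = fact j * F $ i"
  by (metis fps_mult_left_const_nth of_nat_fact fps_of_nat)

lemma diff_op2_nth_0:
  fixes p :: "'a::{idom, ring_char_0} poly"
  assumes "degree p < M" "degree q < N"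
  shows "diff_op (\<lambda>c. fps_const (fps_const [:c:])) partial1 p
      (diff_op (\<lambda>c. fps_const (fps_const [:c:])) partial2 q Q) $ 0 $ 0 =
    (\<Sum>i<M. \<Sum>j<N. smult (poly.coeff p i * poly.coeff q j * fact i * fact j) (Q $ j $ i))"
proof -
  \<comment> \<open>An equation between functions, so that it also rewrites the iterates of
    \<open>partial2\<close>.\<close>
  have partial2: "(partial2 :: 'a poly fps fps \<Rightarrow> _) = fps_deriv"
    by (rule ext) (simp add: partial2_def)
  show ?thesis
    by (simp add: partial2 diff_op_sum_lessThan[OF assms(1)] diff_op_sum_lessThan[OF assms(2)]
        fps_sum_nth fps_0th_higher_deriv partial1_funpow_nth fps_fact_mult_nth
        sum_distrib_left smult_sum_right fact_mult_poly mult_ac)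
qed

section \<open>Expansion of both solutions up to order x^4\<close>

lemma series_inv_low_nth:
  assumes "f $ 0 = (1 :: 'a::comm_ring_1)"
  shows "series_inv f $ 0 = 1"
    and "series_inv f $ 1 = - (f $ 1)"
    and "series_inv f $ 2 = (f $ 1)\<^sup>2 - f $ 2"
    and "series_inv f $ 3 = 2 * f $ 1 * f $ 2 - (f $ 1) ^ 3 - f $ 3"
  unfolding series_inv_def
  by (simp_all add: numeral_eq_Suc algebra_simps)

text \<open>The fractions 1/2 and 1/6 enter as constant polynomials; this relation is what the later
  ring computations use about them.\<close>

lemma numeral_times_mp_const: "numeral w * mp_const (1 / numeral w) = 1"
  by (metis mp_const_1 mp_const_mult mp_const_of_nat nonzero_mult_div_cancel_left
      of_nat_numeral times_divide_eq_right zero_neq_numeral)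

text \<open>\<open>K $ 3\<close> enters first at order x^4, where only the coefficient of
  \<open>L\<close> is read off.\<close>

lemma kernel1_low_nth:
  defines "K \<equiv> kernel1 :: (nat, 'k::field_char_0) mpol poly fps"
  shows "K $ 0 = [:0, mp_var 0:]"
    and "K $ 1 = [:0, mp_var 1, mp_const (1/2) * mp_var 0:]"
    and "K $ 2 = [:0, mp_var 2, mp_const (1/2) * mp_var 1, mp_const (1/6) * mp_var 0:]"
    and "poly.coeff (K $ 3) 1 = mp_var 3"
  by (simp_all add: K_def kernel1_nth numeral_eq_Suc monom_Suc monom_0 mp_const_1)

lemma kernel2_nth:
  "kernel2 $ j $ i = (\<Sum>n\<le>j. \<Sum>m\<le>i. monom (mp_const (1 / fact (Suc (m + n))) *
     of_nat (m + n choose m) * mp_var (i - m, j - n)) (Suc (m + n)))"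
  by (simp add: kernel2_eq fps_mult_nth fps_sum_nth exp2_quot_nth B2_def atLeast0AtMost mult_monom
    flip: monom_0)

lemma kernel2_low_nth:
  defines "K \<equiv> kernel2 :: (nat \<times> nat, 'k::field_char_0) mpol poly fps fps"
  shows "K $ 0 $ 0 = [:0, mp_var (0, 0):]"
    and "K $ 0 $ 1 = [:0, mp_var (1, 0), mp_const (1/2) * mp_var (0, 0):]"
    and "K $ 1 $ 0 = [:0, mp_var (0, 1), mp_const (1/2) * mp_var (0, 0):]"
    and "K $ 0 $ 2 = [:0, mp_var (2, 0), mp_const (1/2) * mp_var (1, 0), mp_const (1/6) * mp_var (0, 0):]"
    and "K $ 2 $ 0 = [:0, mp_var (0, 2), mp_const (1/2) * mp_var (0, 1), mp_const (1/6) * mp_var (0, 0):]"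
    and "K $ 1 $ 1 = [:0, mp_var (1, 1), mp_const (1/2) * (mp_var (1, 0) + mp_var (0, 1)),
     mp_const (1/6) * 2 * mp_var (0, 0):]"
    and "poly.coeff (K $ j $ i) 1 = mp_var (i, j)"
proof -
  show "poly.coeff (K $ j $ i) 1 = mp_var (i, j)"
    by (simp add: K_def kernel2_nth coeff_sum sum.atMost_shift mp_const_1)
qed (simp_all add: K_def kernel2_nth numeral_eq_Suc monom_Suc monom_0 mp_const_1 algebra_simps)

text \<open>Inside the proof, orders 1 to 3 are computed as full polynomials in \<open>L\<close>,
  because \<open>L\<close> turns into a derivative at later orders. At order 4 the coefficient of
  \<open>L\<close> suffices.\<close>

lemma dse1_low_nth:
  fixes G :: "(nat, 'k::field_char_0) mpol poly fps"
  assumes "dse1_solution G"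
  defines "a \<equiv> mp_var :: nat \<Rightarrow> (nat, 'k) mpol"
  shows "G $ 1 = [:0, a 0:]"
    and "poly.coeff (G $ 2) 1 = - 2 * a 0 * a 1"
    and "poly.coeff (G $ 3) 1 = 4 * a 0 * (a 1)\<^sup>2 + 10 * (a 0)\<^sup>2 * a 2"
    and "poly.coeff (G $ 4) 1 =
      - 8 * a 0 * a 1 ^ 3 - 72 * (a 0)\<^sup>2 * a 1 * a 2 - 80 * a 0 ^ 3 * a 3"
proof -
  define h t :: "(nat, 'k) mpol" where "h = mp_const (1/2)" and "t = mp_const (1/6)"
  have ht: "2 * h = 1" "6 * t = 1"
    unfolding h_def t_def by (rule numeral_times_mp_const)+
  have G0: "G $ 0 = 1"
    by (rule dse1_nth_0) fact
  let ?D = "\<lambda>p. diff_op (\<lambda>c. fps_const [:c:]) fps_deriv p kernel1 $ 0"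
  have step: "G $ Suc n = ?D (((series_inv G)\<^sup>2) $ n)" for n
    using assms(1) dse1_rhs_nth(2) unfolding dse1_solution_def by metis
  note K = kernel1_low_nth[where 'k = 'k, folded a_def h_def t_def]
  note inv = series_inv_low_nth[OF G0]
  let ?P = "series_inv G"
  \<comment> \<open>The factors 2 and 6 are 2! and 3!. Shorter polynomials are padded with zeros
    below so that this one formula fits every order.\<close>
  have D: "?D [:c0, c1, c2, c3:] = smult c0 (kernel1 $ 0) + smult c1 (kernel1 $ 1)
      + smult (2 * c2) (kernel1 $ 2) + smult (6 * c3) (kernel1 $ 3)"
    for c0 c1 c2 c3 :: "(nat, 'k) mpol"
    by (subst diff_op1_nth_0[where N = 4])
      (simp_all add: numeral_eq_Suc degree_pCons_eq_if algebra_simps)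
  have sq: "((series_inv G)\<^sup>2) $ 0 = 1"
     "((series_inv G)\<^sup>2) $ 1 = 2 * ?P $ 1"
     "((series_inv G)\<^sup>2) $ 2 = 2 * ?P $ 2 + (?P $ 1)\<^sup>2"
     "((series_inv G)\<^sup>2) $ 3 = 2 * ?P $ 3 + 2 * (?P $ 1) * ?P $ 2"
    unfolding power2_eq_square fps_mult_nth
    by (simp_all add: numeral_eq_Suc inv(1))
  show G1: "G $ 1 = [:0, a 0:]"
    using step[of 0] D[of 1 0 0 0] by (simp add: sq K flip: one_pCons)
  have sq1: "((series_inv G)\<^sup>2) $ 1 = [:0, - 2 * a 0, 0, 0:]"
    unfolding sq inv G1 by (simp add: numeral_poly)
  have G2: "G $ 2 = [:0, - 2 * a 0 * a 1, - (a 0)\<^sup>2:]"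
    using step[of 1] unfolding sq1 D K by (simp add: numeral_2_eq_2 ht)
  show "poly.coeff (G $ 2) 1 = - 2 * a 0 * a 1"
    by (simp add: G2)
  have sq2: "((series_inv G)\<^sup>2) $ 2 = [:0, 4 * a 0 * a 1, 5 * (a 0)\<^sup>2, 0:]"
    unfolding sq inv G1 G2 by (simp add: numeral_poly power2_eq_square)
  have G3: "G $ 3 = [:0, 4 * a 0 * (a 1)\<^sup>2 + 10 * (a 0)\<^sup>2 * a 2,
      7 * (a 0)\<^sup>2 * a 1, 10 * t * a 0 ^ 3:]"
    using step[of 2] unfolding sq2 D K
    by (simp add: numeral_3_eq_3 power2_eq_square power3_eq_cube ht)
  show "poly.coeff (G $ 3) 1 = 4 * a 0 * (a 1)\<^sup>2 + 10 * (a 0)\<^sup>2 * a 2"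
    by (simp add: G3)
  have sq3: "((series_inv G)\<^sup>2) $ 3 = [:0, - 8 * a 0 * (a 1)\<^sup>2 - 20 * (a 0)\<^sup>2 * a 2,
      - 26 * (a 0)\<^sup>2 * a 1, - 20 * t * a 0 ^ 3 - 10 * a 0 ^ 3:]"
    unfolding sq inv G1 G2 G3
    by (simp add: numeral_poly power2_eq_square power3_eq_cube algebra_simps)
  show "poly.coeff (G $ 4) 1 =
      - 8 * a 0 * a 1 ^ 3 - 72 * (a 0)\<^sup>2 * a 1 * a 2 - 80 * a 0 ^ 3 * a 3"
    using arg_cong[OF step[of 3], of "\<lambda>p. poly.coeff p 1"]
    unfolding sq3 D coeff_add coeff_smult K
    by simp (use ht in algebra)
qed

lemma dse2_low_nth:
  fixes G :: "(nat \<times> nat, 'k::field_char_0) mpol poly fps"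
  assumes "dse2_solution G"
  defines "b \<equiv> mp_var :: nat \<times> nat \<Rightarrow> (nat \<times> nat, 'k) mpol"
  defines "s \<equiv> b (1, 0) + b (0, 1)" and "q \<equiv> b (2, 0) + b (0, 2)"
  shows "G $ 1 = [:0, b (0, 0):]"
    and "poly.coeff (G $ 2) 1 = - b (0, 0) * s"
    and "poly.coeff (G $ 3) 1 = b (0, 0) * s\<^sup>2 + (b (0, 0))\<^sup>2 * (4 * q + b (1, 1))"
    and "poly.coeff (G $ 4) 1 = - b (0, 0) * s ^ 3 - 3 * (b (0, 0))\<^sup>2 * s * (5 * q + b (1, 1))
      - 4 * b (0, 0) ^ 3 * (7 * (b (3, 0) + b (0, 3)) + b (2, 1) + b (1, 2))"
proof -
  define h t :: "(nat \<times> nat, 'k) mpol" where "h = mp_const (1/2)" and "t = mp_const (1/6)"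
  have ht: "2 * h = 1" "6 * t = 1"
    unfolding h_def t_def by (rule numeral_times_mp_const)+
  have G0: "G $ 0 = 1"
    by (rule dse2_nth_0) fact
  let ?D = "\<lambda>p q. diff_op (\<lambda>c. fps_const (fps_const [:c:])) partial1 p
       (diff_op (\<lambda>c. fps_const (fps_const [:c:])) partial2 q kernel2) $ 0 $ 0"
  let ?P = "series_inv G"
  have "G $ Suc n = (\<Sum>m\<le>n. ?D (?P $ m) (?P $ (n - m)))" for n
    using dse2_rhs_nth(2)[of G n] assms(1) unfolding dse2_solution_def by simp
  note this[of 0] this[of 1] this[of 2] this[of 3]
  then have step:
    "G $ 1 = ?D (?P $ 0) (?P $ 0)"
    "G $ 2 = ?D (?P $ 0) (?P $ 1) + ?D (?P $ 1) (?P $ 0)"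
    "G $ 3 = ?D (?P $ 0) (?P $ 2) + ?D (?P $ 1) (?P $ 1) + ?D (?P $ 2) (?P $ 0)"
    "G $ 4 = ?D (?P $ 0) (?P $ 3) + ?D (?P $ 1) (?P $ 2)
      + ?D (?P $ 2) (?P $ 1) + ?D (?P $ 3) (?P $ 0)"
    by (simp_all add: numeral_eq_Suc)
  note K = kernel2_low_nth[where 'k = 'k, folded b_def h_def t_def]
  note inv = series_inv_low_nth[OF G0]
  \<comment> \<open>The weight of \<open>kernel2 $ j $ i\<close> is i! * j! * xi * yj: the first
    polynomial acts on \<rho>1, whose exponent is the inner index.\<close>
  have D: "?D [:x0, x1, x2, x3:] [:y0, y1, y2, y3:] =
      smult (x0 * y0) (kernel2 $ 0 $ 0) + smult (x0 * y1) (kernel2 $ 1 $ 0) +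
      smult (2 * x0 * y2) (kernel2 $ 2 $ 0) + smult (6 * x0 * y3) (kernel2 $ 3 $ 0) +
      smult (x1 * y0) (kernel2 $ 0 $ 1) + smult (x1 * y1) (kernel2 $ 1 $ 1) +
      smult (2 * x1 * y2) (kernel2 $ 2 $ 1) + smult (6 * x1 * y3) (kernel2 $ 3 $ 1) +
      smult (2 * x2 * y0) (kernel2 $ 0 $ 2) + smult (2 * x2 * y1) (kernel2 $ 1 $ 2) +
      smult (4 * x2 * y2) (kernel2 $ 2 $ 2) + smult (12 * x2 * y3) (kernel2 $ 3 $ 2) +
      smult (6 * x3 * y0) (kernel2 $ 0 $ 3) + smult (6 * x3 * y1) (kernel2 $ 1 $ 3) +
      smult (12 * x3 * y2) (kernel2 $ 2 $ 3) + smult (36 * x3 * y3) (kernel2 $ 3 $ 3)"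
    for x0 x1 x2 x3 y0 y1 y2 y3 :: "(nat \<times> nat, 'k) mpol"
    by (subst diff_op2_nth_0[where M = 4 and N = 4])
      (simp_all add: numeral_eq_Suc degree_pCons_eq_if mult_ac add_ac)
  have P0: "?P $ 0 = [:1, 0, 0, 0:]"
    by (simp add: inv flip: one_pCons)
  show G1: "G $ 1 = [:0, b (0, 0):]"
    using step(1) unfolding P0 D K by simp
  have P1: "?P $ 1 = [:0, - b (0, 0), 0, 0:]"
    unfolding inv G1 by simp
  have G2: "G $ 2 = [:0, - b (0, 0) * s, - (b (0, 0))\<^sup>2:]"
    unfolding s_def
    using step(2) unfolding P0 P1 D K by (simp add: ht power2_eq_square distrib_left add_ac)
  show "poly.coeff (G $ 2) 1 = - b (0, 0) * s"
    by (simp add: G2)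
  have P2: "?P $ 2 = [:0, b (0, 0) * s, 2 * (b (0, 0))\<^sup>2, 0:]"
    unfolding inv G1 G2 by (simp add: power2_eq_square)
  \<comment> \<open>The 7 collects 2 + 4 + 1 halves: from the degree-1 terms, the pure second
    derivatives and the mixed one.\<close>
  have G3: "G $ 3 = [:0, b (0, 0) * s\<^sup>2 + (b (0, 0))\<^sup>2 * (4 * q + b (1, 1)),
      7 * h * (b (0, 0))\<^sup>2 * s, 10 * t * b (0, 0) ^ 3:]"
    unfolding s_def q_def
    using step(3) unfolding P0 P1 P2 D K
    by (simp add: s_def power2_eq_square power3_eq_cube algebra_simps)
  show "poly.coeff (G $ 3) 1 = b (0, 0) * s\<^sup>2 + (b (0, 0))\<^sup>2 * (4 * q + b (1, 1))"
    by (simp add: G3)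
  have P3: "?P $ 3 = [:0, - b (0, 0) * s\<^sup>2 - (b (0, 0))\<^sup>2 * (4 * q + b (1, 1)),
      - (7 * h + 2) * (b (0, 0))\<^sup>2 * s, - (10 * t + 3) * b (0, 0) ^ 3:]"
    unfolding inv G1 G2 G3 by (simp add: numeral_poly power2_eq_square power3_eq_cube algebra_simps)
  show "poly.coeff (G $ 4) 1 = - b (0, 0) * s ^ 3 - 3 * (b (0, 0))\<^sup>2 * s * (5 * q + b (1, 1))
      - 4 * b (0, 0) ^ 3 * (7 * (b (3, 0) + b (0, 3)) + b (2, 1) + b (1, 2))"
    unfolding step(4) P0 P1 P2 P3 D coeff_add coeff_smult K(7) s_def q_def
    by simp (use ht in algebra)
qed

section \<open>Comparison of the linear coefficients in L\<close>

text \<open>Here \<open>\<sigma>\<close> is any polynomial substitution, so linear forms are covered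
  as a special case.\<close>

lemma series_subst_dse1_neq_dse2:
  fixes G :: "(nat, 'k::field_char_0) mpol poly fps"
    and Ghat :: "(nat \<times> nat, 'k) mpol poly fps"
  assumes G: "dse1_solution G" and Ghat: "dse2_solution Ghat"
  shows "series_subst \<sigma> G \<noteq> Ghat"
proof
  assume eq: "series_subst \<sigma> G = Ghat"
  define b where "b = (mp_var :: nat \<times> nat \<Rightarrow> (nat \<times> nat, 'k) mpol)"
  have match: "mp_subst \<sigma> (poly.coeff (G $ n) 1) = poly.coeff (Ghat $ n) 1" for n
    by (simp add: eq[symmetric] series_subst_def coeff_map_poly mp_subst_0)
  note hom = mp_subst_add mp_subst_diff mp_subst_uminus mp_subst_mult mp_subst_power
    mp_subst_numeral mp_subst_var
  define \<beta> s p q r u where "\<beta> = b (0, 0)" and "s = b (1, 0) + b (0, 1)" and "p = b (1, 1)"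
    and "q = b (2, 0) + b (0, 2)" and "r = b (3, 0) + b (0, 3)" and "u = b (2, 1) + b (1, 2)"
  note low1 = dse1_low_nth[OF G]
  note low2 = dse2_low_nth[OF Ghat, folded b_def, folded \<beta>_def s_def p_def q_def r_def]
  have \<beta>: "\<beta> \<noteq> 0"
    by (simp add: \<beta>_def b_def mp_var_nonzero)
  have 0: "\<sigma> 0 = \<beta>"
    using match[of 1] unfolding low1 low2 by (simp add: hom)
  have "\<beta> * (2 * \<sigma> 1) = \<beta> * s"
    using match[of 2] unfolding low1 low2 hom 0 by (simp add: mult_ac)
  then have 1: "s = 2 * \<sigma> 1"
    using \<beta> by simp
  have "4 * \<beta> * (\<sigma> 1)\<^sup>2 + 10 * \<beta>\<^sup>2 * \<sigma> 2 = \<beta> * s\<^sup>2 + \<beta>\<^sup>2 * (4 * q + p)"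
    using match[of 3] unfolding low1 low2 hom 0 .
  \<comment> \<open>The terms linear in \<beta> cancel because s is twice
    \<open>\<sigma> 1\<close>.\<close>
  then have "\<beta>\<^sup>2 * (10 * \<sigma> 2) = \<beta>\<^sup>2 * (4 * q + p)"
    unfolding 1 by algebra
  then have 2: "10 * \<sigma> 2 = 4 * q + p"
    using \<beta> by simp
  have "- 8 * \<beta> * \<sigma> 1 ^ 3 - 72 * \<beta>\<^sup>2 * \<sigma> 1 * \<sigma> 2 - 80 * \<beta> ^ 3 * \<sigma> 3 =
      - \<beta> * s ^ 3 - 3 * \<beta>\<^sup>2 * s * (5 * q + p) - 4 * \<beta> ^ 3 * (7 * r + u)"
    using match[of 4] unfolding low1 low2 hom 0 u_def by (simp add: add.assoc)
  \<comment> \<open>The cubic terms in s cancel. Multiplying by 5 turns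
    \<open>72 * \<sigma> 1 * \<sigma> 2\<close> into \<open>18 * s * (10 * \<sigma> 2)\<close>, from
    which \<open>\<sigma> 2\<close> is eliminated; 75 - 72 and 15 - 18 leave the factors 3 and
    -3.\<close>
  then have "\<beta>\<^sup>2 * (3 * s * (q - p)) = \<beta>\<^sup>2 * (20 * \<beta> * (20 * \<sigma> 3 - 7 * r - u))"
    using 1 2 by algebra
  then have obstruction: "3 * s * (q - p) = 20 * \<beta> * (20 * \<sigma> 3 - 7 * r - u)"
    using \<beta> by simp
  \<comment> \<open>This point has \<beta> = 0, which removes the unknown \<open>\<sigma> 3\<close>,
    while the left side becomes -3, nonzero in characteristic 0.\<close>
  define \<tau> :: "nat \<times> nat \<Rightarrow> (nat \<times> nat, 'k) mpol"
    where "\<tau> v = (if v \<in> {(1, 0), (1, 1)} then 1 else 0)" for v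
  have "mp_subst \<tau> s = 1" "mp_subst \<tau> q = 0" "mp_subst \<tau> p = 1" "mp_subst \<tau> \<beta> = 0"
    by (simp_all add: s_def q_def p_def \<beta>_def b_def hom \<tau>_def)
  then show False
    using arg_cong[OF obstruction, of "mp_subst \<tau>"] by (simp add: hom)
qed

theorem mainTheorem5:
  fixes G :: "(nat, 'k::field_char_0) mpol poly fps"
    and Ghat :: "(nat \<times> nat, 'k) mpol poly fps"
  assumes "dse1_solution G" and "dse2_solution Ghat"
  shows "\<not> (\<exists>c :: nat \<Rightarrow> (nat \<times> nat) \<Rightarrow>\<^sub>0 'k.
    series_subst (\<lambda>k. mp_linear_form (c k)) G = Ghat)"
  using series_subst_dse1_neq_dse2[OF assms] by blast

end
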